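(* The $(1-\varepsilon)$-competition complexity of the correlated prophet inequality with $n$ rewards for the adversarial arrival order is $\Theta(n/\varepsilon)$.
   Context: Let $F$ be a known joint distribution over sequences $v=(v_1,\dots,v_n)\in\mathbb{R}_{\ge0}^n$ (arbitrary correlations between coordinates allowed), and let $\varepsilon>0$. Standing assumptions: $F$ is discrete and every $v$ in its support has a unique maximal coordinate. Draw $k$ independent copies $v^{(1)},\dots,v^{(k)}\sim F$. In the adversarial arrival model the $nk$ rewards $v^{(t)}_i$ ($1\le t\le k$, $1\le i\le n$) are revealed one by one in an arbitrary (adversarial) order, not necessarily copy by copy; when a reward arrives, its value and its identity (in particular its type $i$) are known. A (possibly randomized) online algorithm, knowing $F$, must upon each arrival decide irrevocably to select the reward and stop, or to discard it; $\mathrm{ALG}(v)$ is the selected value ($0$ if none). The $(1-\varepsilon)$-competition complexity for the adversarial arrival order is the smallest positive integer $k_0=k_0(n,\varepsilon)$ such that for every such $F$ and every $k\ge k_0$ there is an online algorithm $\mathrm{ALG}$ which, for every arrival order of the $nk$ rewards, satisfies $\mathbb{E}_{v\sim F^k}[\mathrm{ALG}(v)]\ge(1-\varepsilon)\,\mathbb{E}_{v\sim F}[\max_i v_i]$. *)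

theory Defs
  imports
    "HOL-Probability.Probability"
    "HOL-Library.Landau_Symbols"
    "HOL-Combinatorics.Multiset_Permutations"
begin

text \<open>
  A valuation is a function in \<open>{..<n} \<rightarrow>\<^sub>E {0..}\<close>, i.e. a vector in the nonnegative orthant
  with coordinates indexed by \<open>0, \<dots>, n - 1\<close>. A \<open>pmf\<close> is exactly a discrete distribution;
  no relation between the coordinates is assumed. The expectation of the maximum may be infinite:
  all expectations below are \<open>ennreal\<close>-valued.
\<close>

definition reward_distribution :: "nat \<Rightarrow> (nat \<Rightarrow> real) pmf \<Rightarrow> bool" where
  "reward_distribution n F \<longleftrightarrow>
     (\<forall>v\<in>set_pmf F. v \<in> {..<n} \<rightarrow>\<^sub>E {0..} \<and> (\<exists>!i. i < n \<and> (\<forall>j<n. v j \<le> v i)))"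

definition expected_max :: "nat \<Rightarrow> (nat \<Rightarrow> real) pmf \<Rightarrow> ennreal" where
  "expected_max n F = (\<integral>\<^sup>+ v. ennreal (Max (v ` {..<n})) \<partial>measure_pmf F)"

text \<open>The identity \<open>(t, i)\<close> of a reward consists of its copy \<open>t\<close> and its type \<open>i\<close>.\<close>

type_synonym reward = "(nat \<times> nat) \<times> real"

text \<open>
  A randomized online algorithm maps the list of rewards revealed so far, whose last element is the
  current arrival and all of whose earlier elements were discarded, to its random decision whether
  to select the current arrival.
\<close>

type_synonym online_alg = "reward list \<Rightarrow> bool pmf"

text \<open>Distribution of the selected value; the second argument lists the rewards already discarded.\<close>

primrec run :: "online_alg \<Rightarrow> reward list \<Rightarrow> reward list \<Rightarrow> real pmf" where
  "run A h [] = return_pmf 0"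
| "run A h (r # rs) =
     bind_pmf (A (h @ [r]))
       (\<lambda>select. if select then return_pmf (snd r) else run A (h @ [r]) rs)"

text \<open>An arrival order lists every identity once; it is fixed independently of the values.\<close>

definition arrival_orders :: "nat \<Rightarrow> nat \<Rightarrow> (nat \<times> nat) list set" where
  "arrival_orders n k = permutations_of_set ({..<k} \<times> {..<n})"

definition expected_alg ::
  "(nat \<Rightarrow> real) pmf \<Rightarrow> nat \<Rightarrow> online_alg \<Rightarrow> (nat \<times> nat) list \<Rightarrow> ennreal" where
  "expected_alg F k A ord =
     (\<integral>\<^sup>+ x. ennreal x \<partial>measure_pmf
        (bind_pmf (Pi_pmf {..<k} undefined (\<lambda>_. F))
          (\<lambda>v. run A [] (map (\<lambda>(t, i). ((t, i), v t i)) ord))))"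

definition sufficient_copies :: "nat \<Rightarrow> real \<Rightarrow> nat \<Rightarrow> bool" where
  "sufficient_copies n \<epsilon> k\<^sub>0 \<longleftrightarrow>
     0 < k\<^sub>0 \<and>
     (\<forall>F. reward_distribution n F \<longrightarrow>
       (\<forall>k\<ge>k\<^sub>0. \<exists>A. \<forall>ord\<in>arrival_orders n k.
          expected_alg F k A ord \<ge> ennreal (1 - \<epsilon>) * expected_max n F))"

definition competition_complexity :: "nat \<Rightarrow> real \<Rightarrow> nat" where
  "competition_complexity n \<epsilon> = (LEAST k\<^sub>0. sufficient_copies n \<epsilon> k\<^sub>0)"

text \<open>
  With the filter \<open>principal D\<close>, a Landau bound has one constant valid at every point of \<open>D\<close>.
  A lower bound of order \<open>n / \<epsilon>\<close> needs \<open>n \<ge> 2\<close> and \<open>\<epsilon>\<close> bounded away from 1: the complexity is 1 for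
  \<open>n = 1\<close>, and also for \<open>\<epsilon> \<ge> 1 - 1 / n\<close>.
\<close>

end

theory Submission imports Defs begin

text \<open>
  Upper bound. Let \<open>OPT\<close> be the expected maximum and \<open>T = (1 - \<epsilon>) OPT\<close>. Select every reward
  exceeding \<open>T\<close> with probability \<open>c = 1 / (2 n)\<close>. Let \<open>Q\<close> be the probability of selecting nothing.
  Up to \<open>T\<close>, a selected value contributes \<open>T (1 - Q)\<close>; the excess over \<open>T\<close> of each copy's maximum
  is collected with probability at least \<open>c (1 - c) ^ n Q'\<close>, where \<open>Q' \<ge> Q\<close> refers to the other copies
  only and is independent of this copy: subsampling is what defeats the correlation inside a copy.
  As the expected excess per copy is at least \<open>\<epsilon> OPT\<close> and \<open>c (1 - c) ^ n \<ge> 1 / (4 n)\<close>, having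
  \<open>k \<ge> 4 n / \<epsilon>\<close> copies gives \<open>T (1 - Q) + Q OPT \<ge> T\<close>. If \<open>OPT\<close> is infinite, \<open>T = 0\<close> works.

  Lower bound. Type 0 always has value 1. The types \<open>1, \<dots>, n - 1\<close> form a martingale of mean \<open>B\<close>
  that is multiplied by \<open>1 / \<delta>\<close> with probability \<open>\<delta>\<close> and dies otherwise. Its expected maximum is
  about \<open>(n - 1) B\<close>, but by optional stopping an algorithm gets only \<open>B\<close> from one copy. If all rewards
  of type 0 come first, the algorithm chooses between 1 and at most \<open>k B\<close>, whereas
  the expected maximum is about \<open>1 + (n - 1) B\<close>; take \<open>B\<close> of order \<open>\<epsilon> / n\<close> and \<open>\<delta> \<rightarrow> 0\<close>.
\<close>

section \<open>Stopping probabilities for fixed values and a fixed order\<close>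

text \<open>The probability that \<open>A\<close> discards all of \<open>xs\<close>: each decision
  is drawn afresh given the full history, so the conditional discard probabilities multiply.\<close>

definition survival :: "online_alg \<Rightarrow> reward list \<Rightarrow> real" where
  "survival A xs = (\<Prod>q<length xs. pmf (A (take (Suc q) xs)) False)"

definition reveal :: "(nat \<Rightarrow> nat \<Rightarrow> real) \<Rightarrow> (nat \<times> nat) list \<Rightarrow> reward list" where
  "reveal v ord = map (\<lambda>(t, i). ((t, i), v t i)) ord"

text \<open>The loss of survival at position \<open>p\<close> is the probability that exactly this
  arrival is selected.\<close>

definition stop_prob ::
  "online_alg \<Rightarrow> (nat \<times> nat) list \<Rightarrow> (nat \<Rightarrow> nat \<Rightarrow> real) \<Rightarrow> nat \<Rightarrow> real" where
  "stop_prob A ord v p = survival A (reveal v (take p ord)) - survival A (reveal v (take (Suc p) ord))"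

lemma survival_Nil [simp]: "survival A [] = 1"
  by (simp add: survival_def)

lemma survival_snoc: "survival A (xs @ [r]) = survival A xs * pmf (A (xs @ [r])) False"
  by (simp add: survival_def)

lemma survival_nonneg: "0 \<le> survival A xs"
  by (simp add: survival_def prod_nonneg)

lemma survival_snoc_le: "survival A (xs @ [r]) \<le> survival A xs"
  unfolding survival_snoc by (intro mult_right_le_one_le survival_nonneg pmf_nonneg pmf_le_1)

text \<open>Weighting by \<open>survival A h\<close> instead of conditioning on \<open>h\<close>
  avoids dividing by a probability that may vanish, and lets the induction move each discarded
  reward into \<open>h\<close>.\<close>

lemma run_integral:
  "ennreal (survival A h) * (\<integral>\<^sup>+ x. ennreal x \<partial>run A h rs) =
     (\<Sum>p<length rs. ennreal (snd (rs ! p)) *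
        ennreal (survival A (h @ take p rs) - survival A (h @ take (Suc p) rs)))"
proof (induction rs arbitrary: h)
  case Nil
  then show ?case by simp
next
  case (Cons r rs)
  have "(\<integral>\<^sup>+ x. ennreal x \<partial>run A h (r # rs)) =
      ennreal (pmf (A (h @ [r])) True) * ennreal (snd r) +
      ennreal (pmf (A (h @ [r])) False) * (\<integral>\<^sup>+ x. ennreal x \<partial>run A (h @ [r]) rs)"
    by (simp add: nn_integral_measure_pmf[of "A (h @ [r])"]
          nn_integral_count_space_finite UNIV_bool)
  moreover have "ennreal (survival A h) * ennreal (pmf (A (h @ [r])) True) =
      ennreal (survival A h - survival A (h @ [r]))"
    by (simp add: survival_snoc survival_nonneg pmf_False_conv_True algebra_simps flip: ennreal_mult)
  moreover have "ennreal (survival A h) * ennreal (pmf (A (h @ [r])) False) =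
      ennreal (survival A (h @ [r]))"
    by (simp add: survival_snoc survival_nonneg flip: ennreal_mult)
  ultimately have "ennreal (survival A h) * (\<integral>\<^sup>+ x. ennreal x \<partial>run A h (r # rs)) =
      ennreal (survival A h - survival A (h @ [r])) * ennreal (snd r) +
      ennreal (survival A (h @ [r])) * (\<integral>\<^sup>+ x. ennreal x \<partial>run A (h @ [r]) rs)"
    by (simp only: distrib_left flip: mult.assoc)
  then show ?case
    unfolding Cons.IH by (simp add: sum.lessThan_Suc_shift mult.commute del: sum.lessThan_Suc)
qed

lemma stop_prob_nonneg: "p < length ord \<Longrightarrow> 0 \<le> stop_prob A ord v p"
  using survival_snoc_le
  by (fastforce simp: stop_prob_def reveal_def take_Suc_conv_app_nth)

lemma sum_stop_prob:
  "(\<Sum>p<length ord. stop_prob A ord v p) = 1 - survival A (reveal v ord)"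
  unfolding stop_prob_def by (subst sum_lessThan_telescope') (simp add: reveal_def)

text \<open>The coins of the algorithm are integrated out here; afterwards only the values are
  random, and the algorithm enters through its stopping weights.\<close>

lemma expected_alg_eq:
  "expected_alg F k A ord =
     (\<integral>\<^sup>+ v. (\<Sum>p<length ord. ennreal (v (fst (ord ! p)) (snd (ord ! p))) * ennreal (stop_prob A ord v p))
        \<partial>Pi_pmf {..<k} undefined (\<lambda>_. F))"
proof -
  have "(\<integral>\<^sup>+ x. ennreal x \<partial>run A [] (reveal v ord)) =
      (\<Sum>p<length ord. ennreal (v (fst (ord ! p)) (snd (ord ! p))) * ennreal (stop_prob A ord v p))" for v
    using run_integral[of A "[]" "reveal v ord"]
    by (simp add: stop_prob_def reveal_def take_map case_prod_unfold)
  then show ?thesis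
    by (simp add: expected_alg_def reveal_def)
qed

lemma arrival_ordersD:
  assumes "ord \<in> arrival_orders n k"
  shows "distinct ord" "set ord = {..<k} \<times> {..<n}"
  using assms by (auto simp: arrival_orders_def permutations_of_set_def)

section \<open>Randomized threshold algorithms\<close>

definition threshold_alg :: "real \<Rightarrow> real \<Rightarrow> online_alg" where
  "threshold_alg T c = (\<lambda>h. bernoulli_pmf (if T < snd (last h) then c else 0))"

text \<open>The probability that the threshold rule takes nothing from a copy with values
  \<open>w\<close>, whatever the arrival order.\<close>

definition discard_prob :: "real \<Rightarrow> real \<Rightarrow> nat \<Rightarrow> (nat \<Rightarrow> real) \<Rightarrow> real" where
  "discard_prob T c n w = (\<Prod>i<n. if T < w i then 1 - c else 1)"

lemma discard_prob_bounds:
  assumes "0 \<le> c" "c \<le> 1"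
  shows "(1 - c) ^ n \<le> discard_prob T c n w" "discard_prob T c n w \<le> 1"
proof -
  have "(\<Prod>i<n. 1 - c) \<le> discard_prob T c n w"
    unfolding discard_prob_def using assms by (intro prod_mono) auto
  then show "(1 - c) ^ n \<le> discard_prob T c n w" by simp
  show "discard_prob T c n w \<le> 1"
    unfolding discard_prob_def using assms by (intro prod_le_1) auto
qed

lemma survival_threshold_alg:
  assumes "0 \<le> c" "c \<le> 1"
  shows "survival (threshold_alg T c) (reveal v ord) =
    (\<Prod>p<length ord. if T < v (fst (ord ! p)) (snd (ord ! p)) then 1 - c else 1)"
  unfolding survival_def
  using assms by (intro prod.cong)
    (auto simp: reveal_def threshold_alg_def take_Suc_conv_app_nth case_prod_unfold)

lemma bij_betw_arrival_order:
  assumes "ord \<in> arrival_orders n k"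
  shows "bij_betw ((!) ord) {..<length ord} ({..<k} \<times> {..<n})"
  using arrival_ordersD[OF assms] bij_betw_nth by blast

text \<open>Survival never falls below its final value \<open>Q\<close>, so each reward above
  \<open>T\<close> is taken with probability at least \<open>c * Q\<close>. The excess of a copy's
  maximum is at most the sum of the excesses of its rewards.\<close>

lemma threshold_alg_pathwise:
  assumes ord: "ord \<in> arrival_orders n k" and c: "0 \<le> c" "c \<le> 1" and T: "0 \<le> T"
    and n: "1 \<le> n"
  shows "T * (1 - (\<Prod>t<k. discard_prob T c n (v t))) +
      c * (\<Prod>t<k. discard_prob T c n (v t)) * (\<Sum>t<k. max 0 (Max (v t ` {..<n}) - T))
    \<le> (\<Sum>p<length ord. v (fst (ord ! p)) (snd (ord ! p)) * stop_prob (threshold_alg T c) ord v p)"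
proof -
  define val where "val p = v (fst (ord ! p)) (snd (ord ! p))" for p
  define S where "S p = survival (threshold_alg T c) (reveal v (take p ord))" for p
  define Q where "Q = (\<Prod>t<k. discard_prob T c n (v t))"
  let ?s = "stop_prob (threshold_alg T c) ord v"
  \<comment> \<open>The final survival is a product over all identities, hence independent of the
    order.\<close>
  have "S (length ord) = (\<Prod>x\<in>{..<k} \<times> {..<n}. if T < v (fst x) (snd x) then 1 - c else 1)"
    unfolding S_def using survival_threshold_alg[OF c]
    by (simp flip: prod.reindex_bij_betw[OF bij_betw_arrival_order[OF ord]])
  also have "\<dots> = Q"
    by (simp add: Q_def discard_prob_def prod.cartesian_product case_prod_unfold)
  finally have S_end: "S (length ord) = Q" .
  have S_Suc: "S (Suc p) = S p * (if T < val p then 1 - c else 1)" if "p < length ord" for p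
    using that survival_snoc[of "threshold_alg T c" "reveal v (take p ord)"] c
    by (auto simp: S_def val_def reveal_def take_Suc_conv_app_nth case_prod_unfold threshold_alg_def)
  have s: "?s p = S p - S (Suc p)" for p
    by (simp add: stop_prob_def S_def)
  have S_antimono: "Q \<le> S p" if "p \<le> length ord" for p
    unfolding S_end[symmetric] using that
  proof (induction rule: inc_induct)
    case (step q)
    then show ?case using stop_prob_nonneg[of q ord "threshold_alg T c" v] s[of q] by simp
  qed simp
  have "Q \<ge> 0"
    unfolding Q_def discard_prob_def using c by (intro prod_nonneg) auto
  have "c * Q * (\<Sum>t<k. max 0 (Max (v t ` {..<n}) - T)) \<le>
      c * Q * (\<Sum>t<k. \<Sum>i<n. max 0 (v t i - T))"
  proof (intro mult_left_mono sum_mono)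
    fix t
    have "Max (v t ` {..<n}) \<in> v t ` {..<n}"
      using n by (intro Max_in) (auto simp: lessThan_empty_iff)
    then obtain i where i: "i < n" "Max (v t ` {..<n}) = v t i" by auto
    have "max 0 (v t i - T) \<le> (\<Sum>i<n. max 0 (v t i - T))"
      using i by (intro member_le_sum) auto
    then show "max 0 (Max (v t ` {..<n}) - T) \<le> (\<Sum>i<n. max 0 (v t i - T))"
      using i by simp
  qed (use c \<open>Q \<ge> 0\<close> in auto)
  also have "(\<Sum>t<k. \<Sum>i<n. max 0 (v t i - T)) =
      (\<Sum>x\<in>{..<k} \<times> {..<n}. max 0 (v (fst x) (snd x) - T))"
    by (simp add: sum.cartesian_product case_prod_unfold)
  also have "\<dots> = (\<Sum>p<length ord. max 0 (val p - T))"
    unfolding val_def by (simp flip: sum.reindex_bij_betw[OF bij_betw_arrival_order[OF ord]])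
  also have "c * Q * \<dots> \<le> (\<Sum>p<length ord. c * S p * max 0 (val p - T))"
    unfolding sum_distrib_left using S_antimono c
    by (intro sum_mono mult_right_mono mult_left_mono) auto
  finally have "T * (1 - Q) + c * Q * (\<Sum>t<k. max 0 (Max (v t ` {..<n}) - T)) \<le>
      T * (\<Sum>p<length ord. ?s p) + (\<Sum>p<length ord. c * S p * max 0 (val p - T))"
    using S_end by (simp add: sum_stop_prob S_def)
  also have "\<dots> = (\<Sum>p<length ord. T * ?s p + c * S p * max 0 (val p - T))"
    by (simp add: sum_distrib_left sum.distrib)
  \<comment> \<open>If \<open>T < val p\<close>, then \<open>?s p = c * S p\<close> and
    \<open>val p\<close> splits into \<open>T\<close> and its excess; otherwise both sides
    vanish.\<close>
  also have "\<dots> = (\<Sum>p<length ord. val p * ?s p)"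
    by (intro sum.cong) (auto simp: s S_Suc algebra_simps)
  finally show ?thesis by (simp add: Q_def val_def)
qed

lemma expected_alg_ge:
  assumes "reward_distribution n F" and ord: "ord \<in> arrival_orders n k"
    and f: "\<And>v. f v \<le> (\<Sum>p<length ord. v (fst (ord ! p)) (snd (ord ! p)) * stop_prob A ord v p)"
  shows "(\<integral>\<^sup>+ v. ennreal (f v) \<partial>Pi_pmf {..<k} undefined (\<lambda>_. F)) \<le> expected_alg F k A ord"
  unfolding expected_alg_eq
proof (intro nn_integral_mono_AE AE_pmfI)
  fix v assume v: "v \<in> set_pmf (Pi_pmf {..<k} undefined (\<lambda>_. F))"
  let ?x = "\<lambda>p. v (fst (ord ! p)) (snd (ord ! p))"
  have x: "0 \<le> ?x p" if "p < length ord" for p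
  proof -
    have "ord ! p \<in> {..<k} \<times> {..<n}"
      using that nth_mem[OF that] arrival_ordersD(2)[OF ord] by blast
    then have "fst (ord ! p) < k" "snd (ord ! p) < n" by auto
    then have "v (fst (ord ! p)) \<in> set_pmf F"
      using v by (simp add: set_Pi_pmf PiE_dflt_def)
    then have "v (fst (ord ! p)) \<in> {..<n} \<rightarrow>\<^sub>E {0..}"
      using assms(1) by (simp add: reward_distribution_def)
    then show ?thesis using \<open>snd (ord ! p) < n\<close> by (auto dest: PiE_mem)
  qed
  have "ennreal (f v) \<le> ennreal (\<Sum>p<length ord. ?x p * stop_prob A ord v p)"
    using f by (rule ennreal_leI)
  also have "\<dots> = (\<Sum>p<length ord. ennreal (?x p * stop_prob A ord v p))"
    using x stop_prob_nonneg by (intro sum_ennreal[symmetric] mult_nonneg_nonneg) auto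
  also have "\<dots> = (\<Sum>p<length ord. ennreal (?x p) * ennreal (stop_prob A ord v p))"
    using x stop_prob_nonneg by (intro sum.cong) (auto intro!: ennreal_mult)
  finally show "ennreal (f v) \<le> \<dots>" .
qed

section \<open>Expected value of the threshold rule over independent copies\<close>

text \<open>Independence of the copies, in the form that separates the excess of copy
  \<open>t\<close> from the event that all other copies are discarded.\<close>

lemma nn_integral_Pi_pmf_prod_except:
  fixes f g :: "'b \<Rightarrow> ennreal"
  assumes "finite I" "t \<in> I"
  shows "(\<integral>\<^sup>+ v. f (v t) * (\<Prod>s\<in>I - {t}. g (v s)) \<partial>Pi_pmf I d (\<lambda>_. p)) =
    (\<integral>\<^sup>+ x. f x \<partial>p) * (\<integral>\<^sup>+ x. g x \<partial>p) ^ (card I - 1)"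
proof -
  let ?h = "\<lambda>s. if s = t then f else g"
  have "f (v t) * (\<Prod>s\<in>I - {t}. g (v s)) = (\<Prod>s\<in>I. ?h s (v s))" for v
    using assms by (subst prod.remove[of _ t]) auto
  then have "(\<integral>\<^sup>+ v. f (v t) * (\<Prod>s\<in>I - {t}. g (v s)) \<partial>Pi_pmf I d (\<lambda>_. p)) =
      (\<Prod>s\<in>I. \<integral>\<^sup>+ x. ?h s x \<partial>p)"
    using assms nn_integral_prod_Pi_pmf[of I d "\<lambda>_. p" ?h] by simp
  also have "\<dots> = (\<integral>\<^sup>+ x. f x \<partial>p) * (\<Prod>s\<in>I - {t}. \<integral>\<^sup>+ x. g x \<partial>p)"
    using assms by (subst prod.remove[of _ t]) (auto intro!: arg_cong2[where f = times] prod.cong)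
  finally show ?thesis using assms by simp
qed

lemma threshold_alg_value:
  fixes F :: "(nat \<Rightarrow> real) pmf"
  assumes F: "reward_distribution n F" and ord: "ord \<in> arrival_orders n k"
    and c: "0 \<le> c" "c \<le> 1" and T: "0 \<le> T" and n: "1 \<le> n"
  defines "q \<equiv> measure_pmf.expectation F (discard_prob T c n)"
  shows "ennreal (T * (1 - q ^ k)) +
      ennreal (c * (1 - c) ^ n * real k * q ^ k) *
        (\<integral>\<^sup>+ v. ennreal (max 0 (Max (v ` {..<n}) - T)) \<partial>F)
    \<le> expected_alg F k (threshold_alg T c) ord"
proof -
  let ?P = "Pi_pmf {..<k} undefined (\<lambda>_. F)"
  let ?d = "discard_prob T c n"
  let ?Q = "\<lambda>v. \<Prod>t<k. ?d (v t)"
  let ?X = "\<lambda>v. max 0 (Max (v ` {..<n}) - T)"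
  have d0: "0 \<le> ?d w" for w
    unfolding discard_prob_def using c by (intro prod_nonneg) auto
  note d = discard_prob_bounds[OF c, where n = n and T = T]
  have q_int: "(\<integral>\<^sup>+ w. ennreal (?d w) \<partial>F) = ennreal q"
    unfolding q_def using d d0
    by (intro nn_integral_eq_integral measure_pmf.integrable_const_bound[of _ 1]) auto
  have q: "0 \<le> q" "q \<le> 1"
    unfolding q_def using d d0
    by (auto intro!: integral_nonneg_AE measure_pmf.integral_le_const measure_pmf.integrable_const_bound[of _ 1] AE_pmfI)
  have Q: "0 \<le> ?Q v" "?Q v \<le> 1" for v
    using d d0 by (auto intro!: prod_nonneg prod_le_1)
  have Q_int: "(\<integral>\<^sup>+ v. ennreal (?Q v) \<partial>?P) = ennreal (q ^ k)"
    using nn_integral_prod_Pi_pmf[of "{..<k}" undefined "\<lambda>_. F" "\<lambda>_ w. ennreal (?d w)"] d0 q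
    by (simp add: q_int ennreal_power prod_ennreal)
  have "(\<integral>\<^sup>+ v. ennreal (1 - ?Q v) \<partial>?P) + ennreal (q ^ k) = (\<integral>\<^sup>+ v. ennreal (1 - ?Q v) + ennreal (?Q v) \<partial>?P)"
    by (simp add: nn_integral_add Q_int)
  also have "\<dots> = 1"
    using Q by (simp flip: ennreal_plus)
  also have "1 = ennreal (1 - q ^ k) + ennreal (q ^ k)"
    using q by (simp add: power_le_one flip: ennreal_plus)
  finally have A1: "(\<integral>\<^sup>+ v. ennreal (1 - ?Q v) \<partial>?P) = ennreal (1 - q ^ k)"
    by simp
  have "ennreal (q ^ k) * (\<integral>\<^sup>+ v. ennreal (?X v) \<partial>F) \<le>
      (\<integral>\<^sup>+ v. ennreal (?X (v t)) * (\<Prod>s\<in>{..<k} - {t}. ennreal (?d (v s))) \<partial>?P)" if "t < k" for t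
  proof -
    \<comment> \<open>Only \<open>k - 1\<close> other copies must be discarded; the weaker factor
      \<open>q ^ k\<close> matches the probability of selecting nothing.\<close>
    have "ennreal (q ^ k) \<le> ennreal q ^ (k - 1)"
      using q by (auto simp: ennreal_power intro!: ennreal_leI power_decreasing)
    then show ?thesis
      using that q_int
      by (subst nn_integral_Pi_pmf_prod_except)
        (auto simp: mult.commute[of "ennreal (q ^ k)"] intro!: mult_left_mono)
  qed
  then have "(\<Sum>t<k. ennreal (q ^ k) * (\<integral>\<^sup>+ v. ennreal (?X v) \<partial>F)) \<le>
      (\<Sum>t<k. (\<integral>\<^sup>+ v. ennreal (?X (v t)) * (\<Prod>s\<in>{..<k} - {t}. ennreal (?d (v s))) \<partial>?P))"
    by (intro sum_mono) auto
  then have A2: "ennreal (real k * q ^ k) * (\<integral>\<^sup>+ v. ennreal (?X v) \<partial>F) \<le>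
      (\<integral>\<^sup>+ v. (\<Sum>t<k. ennreal (?X (v t)) * (\<Prod>s\<in>{..<k} - {t}. ennreal (?d (v s)))) \<partial>?P)"
    using q by (simp add: nn_integral_sum ennreal_mult ennreal_of_nat_eq_real_of_nat mult.assoc)
  have B: "ennreal T * ennreal (1 - ?Q v) +
      ennreal (c * (1 - c) ^ n) * (\<Sum>t<k. ennreal (?X (v t)) * (\<Prod>s\<in>{..<k} - {t}. ennreal (?d (v s))))
    \<le> ennreal (T * (1 - ?Q v) + c * ?Q v * (\<Sum>t<k. ?X (v t)))" for v
  proof -
    \<comment> \<open>The discard probability of copy \<open>t\<close> is correlated with its own
      excess, so it is replaced by the worst case \<open>(1 - c) ^ n\<close>; what remains depends
      on the other copies only.\<close>
    have "(1 - c) ^ n * (\<Prod>s\<in>{..<k} - {t}. ?d (v s)) \<le> ?Q v" if "t < k" for t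
      using that d d0 by (subst (2) prod.remove[of _ t]) (auto intro!: mult_right_mono prod_nonneg)
    then have "c * (\<Sum>t<k. (1 - c) ^ n * (\<Prod>s\<in>{..<k} - {t}. ?d (v s)) * ?X (v t))
        \<le> c * (\<Sum>t<k. ?Q v * ?X (v t))"
      using c by (intro mult_left_mono sum_mono mult_right_mono) auto
    then have "c * (1 - c) ^ n * (\<Sum>t<k. ?X (v t) * (\<Prod>s\<in>{..<k} - {t}. ?d (v s)))
        \<le> c * ?Q v * (\<Sum>t<k. ?X (v t))"
      by (simp add: sum_distrib_left mult_ac)
    then show ?thesis
      using Q[of v] c T d0
      by (simp add: prod_ennreal prod_nonneg sum_nonneg flip: ennreal_mult ennreal_plus
            del: ennreal_max_0 ennreal_max_0')
  qed
  have "ennreal (T * (1 - q ^ k)) + ennreal (c * (1 - c) ^ n * real k * q ^ k) * (\<integral>\<^sup>+ v. ennreal (?X v) \<partial>F)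
    = ennreal T * ennreal (1 - q ^ k) +
      ennreal (c * (1 - c) ^ n) * (ennreal (real k * q ^ k) * (\<integral>\<^sup>+ v. ennreal (?X v) \<partial>F))"
    using T c q by (simp add: power_le_one mult.assoc flip: ennreal_mult) (simp add: ennreal_mult mult.assoc)
  also have "\<dots> \<le> ennreal T * (\<integral>\<^sup>+ v. ennreal (1 - ?Q v) \<partial>?P) +
      ennreal (c * (1 - c) ^ n) * (\<integral>\<^sup>+ v. (\<Sum>t<k. ennreal (?X (v t)) * (\<Prod>s\<in>{..<k} - {t}. ennreal (?d (v s)))) \<partial>?P)"
    using A1 A2 by (intro add_mono mult_left_mono) auto
  also have "\<dots> = (\<integral>\<^sup>+ v. ennreal T * ennreal (1 - ?Q v) +
      ennreal (c * (1 - c) ^ n) * (\<Sum>t<k. ennreal (?X (v t)) * (\<Prod>s\<in>{..<k} - {t}. ennreal (?d (v s)))) \<partial>?P)"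
    by (simp add: nn_integral_add nn_integral_cmult)
  also have "\<dots> \<le> (\<integral>\<^sup>+ v. ennreal (T * (1 - ?Q v) + c * ?Q v * (\<Sum>t<k. ?X (v t))) \<partial>?P)"
    using B by (intro nn_integral_mono)
  also have "\<dots> \<le> expected_alg F k (threshold_alg T c) ord"
    by (intro expected_alg_ge[OF F ord] threshold_alg_pathwise[OF ord c T n])
  finally show ?thesis .
qed

section \<open>Upper bound on the number of copies\<close>

lemma sufficient_copies_linear:
  assumes n: "1 \<le> n" and \<epsilon>: "0 < \<epsilon>" and k0: "4 * real n / \<epsilon> \<le> real k\<^sub>0"
  shows "sufficient_copies n \<epsilon> k\<^sub>0"
  unfolding sufficient_copies_def
proof (intro conjI allI impI)
  have "0 < 4 * real n / \<epsilon>" using n \<epsilon> by simp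
  then show "0 < k\<^sub>0" using k0 by linarith
  fix F k assume F: "reward_distribution n F" and k: "k\<^sub>0 \<le> k"
  \<comment> \<open>With this \<open>c\<close>, Bernoulli's inequality keeps
    \<open>(1 - c) ^ n\<close> at least 1/2, which yields the factor
    \<open>1 / (4 * n)\<close>.\<close>
  define c where "c = 1 / (2 * real n)"
  have c: "0 < c" "c \<le> 1" "c < 1" using n by (auto simp: c_def)
  have "1 + real n * (- c) \<le> (1 + (- c)) ^ n"
    using c by (intro Bernoulli_inequality) auto
  then have "1 / 2 \<le> (1 - c) ^ n" using n by (simp add: c_def)
  then have "c * (1 / 2) \<le> c * (1 - c) ^ n" using c by (intro mult_left_mono) auto
  then have cc: "1 / (4 * real n) \<le> c * (1 - c) ^ n" by (simp add: c_def)
  have k_gt: "0 < k" and kk: "4 * real n / \<epsilon> \<le> real k" using \<open>0 < k\<^sub>0\<close> k k0 by auto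
  have "1 = 1 / (4 * real n) * (4 * real n / \<epsilon>) * \<epsilon>" using n \<epsilon> by simp
  also have "\<dots> \<le> c * (1 - c) ^ n * real k * \<epsilon>"
    using cc kk n \<epsilon> c by (intro mult_mono mult_nonneg_nonneg) auto
  finally have ck: "1 \<le> c * (1 - c) ^ n * real k * \<epsilon>" .
  define q where "q T = measure_pmf.expectation F (discard_prob T c n)" for T
  have d0: "0 \<le> discard_prob T c n w" for T w
    unfolding discard_prob_def using c by (intro prod_nonneg) auto
  note d = discard_prob_bounds[OF less_imp_le[OF c(1)] c(2), where n = n]
  have d_int: "integrable F (discard_prob T c n)" for T
    using d d0 by (intro measure_pmf.integrable_const_bound[of _ 1]) auto
  have q_le: "q T \<le> 1" for T
    unfolding q_def using d d_int by (auto intro!: measure_pmf.integral_le_const AE_pmfI)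
  have "(1 - c) ^ n \<le> q T" for T
    unfolding q_def using d d_int by (auto intro!: measure_pmf.integral_ge_const AE_pmfI)
  then have q_pos: "0 < q T" for T using c less_le_trans[of 0 "(1 - c) ^ n"] by simp
  have M0: "0 \<le> Max (v ` {..<n})" if v: "v \<in> set_pmf F" for v
  proof -
    have "v \<in> {..<n} \<rightarrow>\<^sub>E {0..}" using F v by (simp add: reward_distribution_def)
    from PiE_mem[OF this, of 0] have "0 \<le> v 0" using n by simp
    also have "v 0 \<le> Max (v ` {..<n})" using n by (intro Max_ge) auto
    finally show ?thesis .
  qed
  show "\<exists>A. \<forall>ord\<in>arrival_orders n k. ennreal (1 - \<epsilon>) * expected_max n F \<le> expected_alg F k A ord"
  proof (cases "\<epsilon> \<ge> 1")
    case True
    then show ?thesis by (simp add: ennreal_neg)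
  next
    case False
    show ?thesis
    proof (cases "expected_max n F")
      case (real opt)
      define T where "T = (1 - \<epsilon>) * opt"
      have T: "0 \<le> T" using real False by (simp add: T_def)
      let ?I = "\<integral>\<^sup>+ v. ennreal (max 0 (Max (v ` {..<n}) - T)) \<partial>F"
      have "ennreal opt \<le> (\<integral>\<^sup>+ v. ennreal (max 0 (Max (v ` {..<n}) - T)) + ennreal T \<partial>F)"
        unfolding real(2)[symmetric] expected_max_def using T
        by (intro nn_integral_mono) (auto simp: max_def simp flip: ennreal_plus intro!: ennreal_leI)
      also have "\<dots> = ?I + ennreal T"
        by (simp add: nn_integral_add)
      \<comment> \<open>Cancelling the finite \<open>T\<close> leaves an expected excess of at least
        \<open>\<epsilon> * opt\<close> per copy.\<close>
      also have "opt = \<epsilon> * opt + T" by (simp add: T_def algebra_simps)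
      finally have I: "ennreal (\<epsilon> * opt) \<le> ?I"
        using T real \<epsilon> by simp
      have "T \<le> opt" using \<epsilon> real by (simp add: T_def algebra_simps)
      have "T = T * (1 - q T ^ k) + T * q T ^ k" by (simp add: algebra_simps)
      also have "\<dots> \<le> T * (1 - q T ^ k) + opt * q T ^ k"
        using q_pos[of T] \<open>T \<le> opt\<close> by (intro add_left_mono mult_right_mono) auto
      \<comment> \<open>The number of copies enters here: the collected excess makes up for
        \<open>opt\<close>, and so for the \<open>T\<close> lost when nothing is selected.\<close>
      also have "opt * q T ^ k \<le> c * (1 - c) ^ n * real k * \<epsilon> * (opt * q T ^ k)"
        using mult_right_mono[OF ck, of "opt * q T ^ k"] q_pos[of T] real by simp
      finally have "ennreal T \<le> ennreal (T * (1 - q T ^ k) + c * (1 - c) ^ n * real k * q T ^ k * (\<epsilon> * opt))"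
        by (intro ennreal_leI) (simp add: mult_ac)
      also have "\<dots> = ennreal (T * (1 - q T ^ k)) + ennreal (c * (1 - c) ^ n * real k * q T ^ k) * ennreal (\<epsilon> * opt)"
        using T c q_pos[of T] q_le[of T] real \<epsilon> by (simp add: power_le_one flip: ennreal_mult ennreal_plus)
      also have "\<dots> \<le> ennreal (T * (1 - q T ^ k)) + ennreal (c * (1 - c) ^ n * real k * q T ^ k) * ?I"
        using I by (intro add_left_mono mult_left_mono) auto
      finally have "ennreal T \<le> expected_alg F k (threshold_alg T c) ord" if "ord \<in> arrival_orders n k" for ord
        using threshold_alg_value[OF F that _ c(2) T n] c unfolding q_def by (auto intro: order_trans)
      moreover have "ennreal (1 - \<epsilon>) * expected_max n F = ennreal T"
        using real False by (simp add: T_def ennreal_mult)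
      ultimately show ?thesis by auto
    next
      case top
      \<comment> \<open>At threshold 0 the excess is the maximum itself, so an infinite mean is
        multiplied by a positive coefficient.\<close>
      have "(\<integral>\<^sup>+ v. ennreal (max 0 (Max (v ` {..<n}) - 0)) \<partial>F) = expected_max n F"
        unfolding expected_max_def using M0
        by (intro nn_integral_cong_AE AE_pmfI) auto
      moreover have "0 < c * (1 - c) ^ n * real k * q 0 ^ k"
        using c k_gt q_pos[of 0] by simp
      ultimately have "expected_alg F k (threshold_alg 0 c) ord = \<top>" if "ord \<in> arrival_orders n k" for ord
        using threshold_alg_value[OF F that _ c(2) order_refl n] c top k_gt q_pos[of 0]
        by (simp add: q_def ennreal_mult_top top_unique)
      then show ?thesis by (intro exI[of _ "threshold_alg 0 c"]) auto
    qed
  qed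
qed

section \<open>Lower bound\<close>

text \<open>The online property: a decision cannot depend on values not yet revealed.\<close>

lemma stop_prob_cong:
  assumes "\<And>x. x \<in> set (take (Suc p) ord) \<Longrightarrow> v (fst x) (snd x) = v' (fst x) (snd x)"
  shows "stop_prob A ord v p = stop_prob A ord v' p"
proof -
  have "set (take p ord) \<subseteq> set (take (Suc p) ord)"
    by (simp add: set_take_subset_set_take)
  then have "reveal v (take p ord) = reveal v' (take p ord)"
    "reveal v (take (Suc p) ord) = reveal v' (take (Suc p) ord)"
    using assms unfolding reveal_def by (auto intro!: map_cong)
  then show ?thesis by (simp add: stop_prob_def)
qed

text \<open>Type 0 comes first and reveals nothing, so the probability \<open>a0\<close> of stopping
  there is a constant. Each copy then yields at most \<open>B * (1 - a0)\<close>, for a total of at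
  most \<open>a0 + k * B * (1 - a0)\<close>.\<close>

lemma expected_alg_le_1:
  fixes F :: "(nat \<Rightarrow> real) pmf" and w :: "nat \<Rightarrow> real"
  assumes ord: "ord \<in> arrival_orders n k" and sorted: "sorted (map snd ord)"
    and safe: "\<And>y. y \<in> set_pmf F \<Longrightarrow> y 0 = 1" "w 0 = 1"
    and chain: "\<And>y i j. y \<in> set_pmf F \<Longrightarrow> j < n \<Longrightarrow> y j \<noteq> 0 \<Longrightarrow> i \<le> j \<Longrightarrow> y i = w i"
    and mean: "\<And>j. 0 < j \<Longrightarrow> j < n \<Longrightarrow> (\<integral>\<^sup>+ y. ennreal (y j) \<partial>F) = ennreal B"
    and B: "0 \<le> B" "real k * B \<le> 1"
  shows "expected_alg F k A ord \<le> 1"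
proof -
  let ?P = "\<lambda>I. Pi_pmf I undefined (\<lambda>_. F)"
  let ?s = "stop_prob A ord"
  let ?val = "\<lambda>v p. v (fst (ord ! p)) (snd (ord ! p)) :: real"
  define N0 where "N0 = {p. p < length ord \<and> snd (ord ! p) = 0}"
  define N1 where "N1 = {p. p < length ord \<and> 0 < snd (ord ! p)}"
  \<comment> \<open>Type 0 has the same value in every copy, so in the first phase the constant
    realization \<open>w\<close> stands for all others.\<close>
  define a where "a p = ?s (\<lambda>_. w) p" for p
  define a0 where "a0 = (\<Sum>p\<in>N0. a p)"
  have N: "{..<length ord} = N0 \<union> N1" "N0 \<inter> N1 = {}" "finite N0" "finite N1"
    by (auto simp: N0_def N1_def)
  have in_range: "fst (ord ! p) < k" "snd (ord ! p) < n" if "p < length ord" for p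
    using nth_mem[OF that] unfolding arrival_ordersD(2)[OF ord] by (auto simp: mem_Times_iff)
  have prefix: "fst x < k" "snd x \<le> snd (ord ! p)"
    if "p < length ord" "x \<in> set (take (Suc p) ord)" for x p
  proof -
    obtain q where q: "q < length (take (Suc p) ord)" "x = take (Suc p) ord ! q"
      using \<open>x \<in> set (take (Suc p) ord)\<close> by (metis in_set_conv_nth)
    then have "q \<le> p" "x = ord ! q" by auto
    then show "fst x < k" "snd x \<le> snd (ord ! p)"
      using sorted_nth_mono[OF sorted, of q p] in_range that(1) by auto
  qed
  have first_phase: "?s v p = a p" if "p \<in> N0" "\<And>t. t < k \<Longrightarrow> v t 0 = 1" for v p
    unfolding a_def using that prefix[of p] safe by (intro stop_prob_cong) (force simp: N0_def)
  have s_nonneg: "0 \<le> ?s v p" if "p \<in> N0 \<union> N1" for v p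
    using that stop_prob_nonneg by (auto simp: N0_def N1_def)
  have s_sum: "(\<Sum>p\<in>N0. ?s v p) + (\<Sum>p\<in>N1. ?s v p) \<le> 1" for v
    using sum_stop_prob[of A ord v] survival_nonneg[of A "reveal v ord"] N
    by (simp add: sum.union_disjoint)
  have a0: "0 \<le> a0" "a0 \<le> 1"
  proof -
    show "0 \<le> a0" unfolding a0_def a_def using s_nonneg by (intro sum_nonneg) auto
    have "0 \<le> (\<Sum>p\<in>N1. ?s (\<lambda>_. w) p)" using s_nonneg by (intro sum_nonneg) auto
    then show "a0 \<le> 1" using s_sum[of "\<lambda>_. w"] by (simp add: a0_def a_def)
  qed
  have contrib0: "(\<integral>\<^sup>+ v. ennreal (?val v p) * ennreal (?s v p) \<partial>?P {..<k}) = ennreal (a p)"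
    if p: "p \<in> N0" for p
  proof -
    have "(\<integral>\<^sup>+ v. ennreal (?val v p) * ennreal (?s v p) \<partial>?P {..<k}) = (\<integral>\<^sup>+ v. ennreal (a p) \<partial>?P {..<k})"
    proof (intro nn_integral_cong_AE AE_pmfI)
      fix v assume "v \<in> set_pmf (?P {..<k})"
      then have v: "v t 0 = 1" if "t < k" for t
        using that safe by (auto simp: set_Pi_pmf PiE_dflt_def)
      have "?val v p = 1" using v p in_range by (simp add: N0_def)
      then show "ennreal (?val v p) * ennreal (?s v p) = ennreal (a p)"
        using first_phase[OF p, of v] v by simp
    qed
    then show ?thesis by simp
  qed
  \<comment> \<open>If \<open>y j\<close> does not vanish, the history up to type \<open>j\<close> cannot tell the copy \<open>y\<close> from \<open>w\<close>. After the
    replacement, the stopping probabilities of all types of this copy belong to a single history, so that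
    their sum is a probability.\<close>
  have contrib1: "(\<integral>\<^sup>+ v. ennreal (?val v p) * ennreal (?s v p) \<partial>?P {..<k}) =
      ennreal B * (\<integral>\<^sup>+ g. ennreal (?s (g(t := w)) p) \<partial>?P ({..<k} - {t}))"
    if p: "p \<in> N1" and t: "fst (ord ! p) = t" for p t
  proof -
    define j where "j = snd (ord ! p)"
    have tj: "t < k" "0 < j" "j < n" "p < length ord"
      using in_range[of p] p t by (auto simp: N1_def j_def)
    have "{..<k} = insert t ({..<k} - {t})" using tj by auto
    then have "?P {..<k} = map_pmf (\<lambda>(y, g). g(t := y)) (pair_pmf F (?P ({..<k} - {t})))"
      using Pi_pmf_insert[of "{..<k} - {t}" t undefined "\<lambda>_. F"] by simp
    then have "(\<integral>\<^sup>+ v. ennreal (?val v p) * ennreal (?s v p) \<partial>?P {..<k}) =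
        (\<integral>\<^sup>+ y. \<integral>\<^sup>+ g. ennreal (y j) * ennreal (?s (g(t := y)) p) \<partial>?P ({..<k} - {t}) \<partial>F)"
      by (simp add: nn_integral_pair_pmf' t j_def)
    also have "\<dots> = (\<integral>\<^sup>+ y. \<integral>\<^sup>+ g. ennreal (y j) * ennreal (?s (g(t := w)) p) \<partial>?P ({..<k} - {t}) \<partial>F)"
    proof (intro nn_integral_cong_AE AE_pmfI nn_integral_cong)
      fix y g assume y: "y \<in> set_pmf F"
      show "ennreal (y j) * ennreal (?s (g(t := y)) p) = ennreal (y j) * ennreal (?s (g(t := w)) p)"
      proof (cases "y j = 0")
        case False
        have "?s (g(t := y)) p = ?s (g(t := w)) p"
          using chain[OF y tj(3) False] prefix[OF tj(4)] unfolding j_def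
          by (intro stop_prob_cong) auto
        then show ?thesis by simp
      qed simp
    qed
    also have "\<dots> = ennreal B * (\<integral>\<^sup>+ g. ennreal (?s (g(t := w)) p) \<partial>?P ({..<k} - {t}))"
      using mean[OF tj(2,3)] by (simp add: nn_integral_cmult nn_integral_multc)
    finally show ?thesis .
  qed
  have copy: "(\<Sum>p\<in>{p\<in>N1. fst (ord ! p) = t}. \<integral>\<^sup>+ v. ennreal (?val v p) * ennreal (?s v p) \<partial>?P {..<k})
      \<le> ennreal (B * (1 - a0))" if t: "t < k" for t
  proof -
    let ?N = "{p\<in>N1. fst (ord ! p) = t}"
    have "(\<Sum>p\<in>?N. \<integral>\<^sup>+ v. ennreal (?val v p) * ennreal (?s v p) \<partial>?P {..<k}) =
        ennreal B * (\<Sum>p\<in>?N. \<integral>\<^sup>+ g. ennreal (?s (g(t := w)) p) \<partial>?P ({..<k} - {t}))"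
      unfolding sum_distrib_left by (intro sum.cong contrib1) auto
    also have "\<dots> = ennreal B * (\<integral>\<^sup>+ g. (\<Sum>p\<in>?N. ennreal (?s (g(t := w)) p)) \<partial>?P ({..<k} - {t}))"
      by (simp add: nn_integral_sum)
    also have "\<dots> \<le> ennreal B * (\<integral>\<^sup>+ g. ennreal (1 - a0) \<partial>?P ({..<k} - {t}))"
    proof (intro mult_left_mono nn_integral_mono_AE AE_pmfI)
      fix g assume g: "g \<in> set_pmf (?P ({..<k} - {t}))"
      \<comment> \<open>The replaced history still has value 1 throughout type 0, so
        \<open>a0\<close> is already spent and at most \<open>1 - a0\<close> is left for later
        types.\<close>
      have "(g(t := w)) r 0 = 1" if "r < k" for r
        using that g safe by (auto simp: set_Pi_pmf PiE_dflt_def)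
      then have "(\<Sum>p\<in>N0. ?s (g(t := w)) p) = a0"
        unfolding a0_def by (intro sum.cong first_phase) auto
      moreover have "(\<Sum>p\<in>?N. ?s (g(t := w)) p) \<le> (\<Sum>p\<in>N1. ?s (g(t := w)) p)"
        using N s_nonneg by (intro sum_mono2) auto
      ultimately have "(\<Sum>p\<in>?N. ?s (g(t := w)) p) \<le> 1 - a0"
        using s_sum[of "g(t := w)"] by simp
      then show "(\<Sum>p\<in>?N. ennreal (?s (g(t := w)) p)) \<le> ennreal (1 - a0)"
        using s_nonneg by (subst sum_ennreal) (auto intro!: ennreal_leI)
    qed auto
    finally show ?thesis using B a0 by (simp add: ennreal_mult)
  qed
  have "expected_alg F k A ord =
      (\<Sum>p\<in>N0 \<union> N1. \<integral>\<^sup>+ v. ennreal (?val v p) * ennreal (?s v p) \<partial>?P {..<k})"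
    unfolding expected_alg_eq N(1) by (simp add: nn_integral_sum)
  also have "\<dots> = (\<Sum>p\<in>N0. ennreal (a p)) +
      (\<Sum>p\<in>N1. \<integral>\<^sup>+ v. ennreal (?val v p) * ennreal (?s v p) \<partial>?P {..<k})"
    using N contrib0 by (simp add: sum.union_disjoint)
  also have "(\<Sum>p\<in>N0. ennreal (a p)) = ennreal a0"
    unfolding a0_def a_def using s_nonneg by (intro sum_ennreal) auto
  also have "(\<Sum>p\<in>N1. \<integral>\<^sup>+ v. ennreal (?val v p) * ennreal (?s v p) \<partial>?P {..<k}) =
      (\<Sum>t<k. \<Sum>p\<in>{p\<in>N1. fst (ord ! p) = t}. \<integral>\<^sup>+ v. ennreal (?val v p) * ennreal (?s v p) \<partial>?P {..<k})"
    using N in_range by (intro sum.group[symmetric]) (auto simp: N1_def)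
  also have "ennreal a0 + \<dots> \<le> ennreal a0 + (\<Sum>t<k. ennreal (B * (1 - a0)))"
    using copy by (intro add_left_mono sum_mono) auto
  also have "\<dots> = ennreal (a0 + real k * B * (1 - a0))"
    using B a0 by (simp add: ennreal_of_nat_eq_real_of_nat mult.assoc flip: ennreal_mult ennreal_plus)
  also have "\<dots> \<le> ennreal (a0 + 1 * (1 - a0))"
    using B a0 by (intro ennreal_leI add_left_mono mult_right_mono) auto
  finally show ?thesis by simp
qed

lemma ex_sorted_arrival_order: "\<exists>ord\<in>arrival_orders n k. sorted (map snd ord)"
proof -
  obtain xs where "set xs = {..<k} \<times> {..<n}" "distinct xs"
    using finite_distinct_list[of "{..<k} \<times> {..<n}"] by auto
  then have "sort_key snd xs \<in> arrival_orders n k"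
    by (simp add: arrival_orders_def permutations_of_set_def)
  then show ?thesis by (intro bexI[of _ "sort_key snd xs"]) auto
qed

section \<open>The hard distribution: a geometric martingale with a safe reward\<close>

definition level :: "real \<Rightarrow> real \<Rightarrow> nat \<Rightarrow> real" where
  "level B \<delta> i = (if i = 0 then 1 else B / \<delta> ^ i)"

text \<open>\<open>J\<close> is the last type at which the martingale is alive; every
  \<open>J\<close> from \<open>n - 1\<close> on gives the path that never dies.\<close>

definition chain :: "real \<Rightarrow> real \<Rightarrow> nat \<Rightarrow> nat \<Rightarrow> nat \<Rightarrow> real" where
  "chain B \<delta> n J = (\<lambda>i\<in>{..<n}. if i \<le> J then level B \<delta> i else 0)"

text \<open>The geometric index has tail probability \<open>\<delta> ^ j\<close> at
  \<open>j\<close>, the chance that the martingale survives \<open>j\<close>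
  multiplications.\<close>

definition chain_pmf :: "real \<Rightarrow> real \<Rightarrow> nat \<Rightarrow> (nat \<Rightarrow> real) pmf" where
  "chain_pmf B \<delta> n = map_pmf (chain B \<delta> n) (geometric_pmf (1 - \<delta>))"

text \<open>The condition \<open>\<delta> < B\<close> serves the first step, from the safe value 1
  up to \<open>B / \<delta>\<close>.\<close>

lemma strict_mono_level:
  assumes "0 < \<delta>" "\<delta> < 1" "\<delta> < B"
  shows "strict_mono (level B \<delta>)"
  unfolding strict_mono_Suc_iff using assms by (auto simp: level_def field_simps)

lemma reward_distribution_chain_pmf:
  assumes \<delta>: "0 < \<delta>" "\<delta> < 1" "\<delta> < B" and n: "1 \<le> n"
  shows "reward_distribution n (chain_pmf B \<delta> n)"
proof -
  note mono = strict_monoD[OF strict_mono_level[OF \<delta>]]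
  have pos: "0 < level B \<delta> i" for i using \<delta> by (simp add: level_def)
  have unique: "\<exists>!i. i < n \<and> (\<forall>j<n. chain B \<delta> n J j \<le> chain B \<delta> n J i)" for J
  proof -
    \<comment> \<open>The unique maximum sits at the last living type: levels increase up to it, and
      zeros follow.\<close>
    define m where "m = min J (n - 1)"
    have m: "m < n" using n by (auto simp: m_def)
    have "chain B \<delta> n J j < chain B \<delta> n J m" if "j < n" "j \<noteq> m" for j
      using that m mono[of j m] pos[of m] by (auto simp: chain_def m_def min_def split: if_splits)
    then show ?thesis
      using m by (intro ex1I[of _ m]) (metis less_imp_le order_refl, metis not_less)
  qed
  show ?thesis
    unfolding reward_distribution_def chain_pmf_def set_map_pmf
    using unique pos by (auto simp: chain_def less_imp_le)
qed

lemma geometric_pmf_tail: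
  assumes "0 < \<delta>" "\<delta> < 1"
  shows "measure_pmf.prob (geometric_pmf (1 - \<delta>)) {j..} = \<delta> ^ j"
proof -
  have "measure_pmf.prob (geometric_pmf (1 - \<delta>)) {..<j} = 1 - \<delta> ^ j"
    using assms by (simp add: measure_measure_pmf_finite one_diff_power_eq mult.commute flip: sum_distrib_left)
  moreover have "{j..} = UNIV - {..<j}" by auto
  ultimately show ?thesis
    using measure_pmf.prob_compl[of "{..<j}" "geometric_pmf (1 - \<delta>)"] by simp
qed

lemma chain_pmf_mean:
  assumes \<delta>: "0 < \<delta>" "\<delta> < 1" and B: "0 \<le> B" and j: "0 < j" "j < n"
  shows "(\<integral>\<^sup>+ y. ennreal (y j) \<partial>chain_pmf B \<delta> n) = ennreal B"
proof -
  let ?G = "geometric_pmf (1 - \<delta>)"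
  have "(\<integral>\<^sup>+ y. ennreal (y j) \<partial>chain_pmf B \<delta> n) =
      (\<integral>\<^sup>+ J. ennreal (level B \<delta> j) * indicator {j..} J \<partial>?G)"
    unfolding chain_pmf_def nn_integral_map_pmf
    using j by (intro nn_integral_cong) (auto simp: chain_def indicator_def)
  also have "\<dots> = ennreal (level B \<delta> j) * ennreal (\<delta> ^ j)"
    using \<delta> by (simp add: nn_integral_cmult measure_pmf.emeasure_eq_measure geometric_pmf_tail)
  also have "\<dots> = ennreal B"
    using \<delta> B j by (simp add: level_def flip: ennreal_mult)
  finally show ?thesis .
qed

text \<open>Dying right after type \<open>j\<close> has probability
  \<open>(1 - \<delta>) * \<delta> ^ j\<close> and leaves the maximum at level \<open>j\<close>.
  This contributes \<open>(1 - \<delta>) * B\<close> for each positive \<open>j\<close> and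
  \<open>1 - \<delta>\<close> for \<open>j = 0\<close>.\<close>

lemma expected_max_chain_pmf:
  assumes \<delta>: "0 < \<delta>" "\<delta> < 1" and B: "0 \<le> B" and n: "1 \<le> n"
  shows "ennreal ((1 - \<delta>) * (1 + real (n - 1) * B)) \<le> expected_max n (chain_pmf B \<delta> n)"
proof -
  let ?G = "geometric_pmf (1 - \<delta>)"
  let ?M = "\<lambda>J. Max (chain B \<delta> n J ` {..<n})"
  have lv: "0 \<le> level B \<delta> j" for j using \<delta> B by (simp add: level_def)
  obtain m where m: "n = Suc m" using n by (cases n) auto
  have "(\<Sum>j<n. pmf ?G j * level B \<delta> j) = (1 - \<delta>) * (1 + real (n - 1) * B)"
    using \<delta> unfolding m
    by (simp add: sum.lessThan_Suc_shift level_def algebra_simps del: sum.lessThan_Suc)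
  then have "ennreal ((1 - \<delta>) * (1 + real (n - 1) * B)) =
      (\<Sum>j<n. ennreal (pmf ?G j * level B \<delta> j))"
    using lv by (subst sum_ennreal) (auto intro!: mult_nonneg_nonneg simp del: pmf_geometric)
  also have "\<dots> \<le> (\<Sum>j<n. ennreal (pmf ?G j) * ennreal (?M j))"
  proof (intro sum_mono)
    fix j assume "j \<in> {..<n}"
    then have "level B \<delta> j = chain B \<delta> n j j" by (simp add: chain_def)
    also have "\<dots> \<le> ?M j" using \<open>j \<in> {..<n}\<close> by (intro Max_ge) auto
    finally show "ennreal (pmf ?G j * level B \<delta> j) \<le> ennreal (pmf ?G j) * ennreal (?M j)"
      using lv[of j] by (simp add: ennreal_mult ennreal_leI mult_left_mono del: pmf_geometric)
  qed
  also have "\<dots> \<le> (\<Sum>j. ennreal (pmf ?G j) * ennreal (?M j))"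
    by (intro sum_le_suminf) auto
  also have "\<dots> = expected_max n (chain_pmf B \<delta> n)"
    by (simp add: expected_max_def chain_pmf_def nn_integral_measure_pmf[of ?G]
          nn_integral_count_space_nat del: pmf_geometric)
  finally show ?thesis .
qed

lemma sufficient_copies_lower:
  assumes suff: "sufficient_copies n \<epsilon> k" and n: "2 \<le> n" and \<epsilon>: "0 < \<epsilon>" "\<epsilon> < 1"
  shows "(1 - \<epsilon>) * real (n - 1) / (2 * \<epsilon>) < real k"
proof (rule ccontr)
  assume "\<not> ?thesis"
  then have k: "real k \<le> (1 - \<epsilon>) * real (n - 1) / (2 * \<epsilon>)" by simp
  \<comment> \<open>Chosen so that
    \<open>(1 - \<epsilon>) * (1 + (n - 1) * B) = 1 + \<epsilon>\<close>, while the assumed bound on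
    \<open>k\<close> becomes \<open>k * B \<le> 1\<close>.\<close>
  define B where "B = 2 * \<epsilon> / ((1 - \<epsilon>) * real (n - 1))"
  have B: "0 < B" using n \<epsilon> by (simp add: B_def)
  have "real k * B \<le> (1 - \<epsilon>) * real (n - 1) / (2 * \<epsilon>) * B"
    using B k by (intro mult_right_mono) auto
  then have kB: "real k * B \<le> 1" using n \<epsilon> by (simp add: B_def)
  \<comment> \<open>The bound \<open>B / 2\<close> makes the levels increase;
    \<open>\<epsilon> / 4\<close> keeps \<open>(1 - \<delta>) * (1 + \<epsilon>)\<close> above
    1.\<close>
  define \<delta> where "\<delta> = min (\<epsilon> / 4) (B / 2)"
  have \<delta>: "0 < \<delta>" "\<delta> < 1" "\<delta> < B" "\<delta> \<le> \<epsilon> / 4" using B \<epsilon> by (auto simp: \<delta>_def min_def)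
  let ?F = "chain_pmf B \<delta> n"
  obtain ord where ord: "ord \<in> arrival_orders n k" "sorted (map snd ord)"
    using ex_sorted_arrival_order by blast
  have "reward_distribution n ?F"
    using \<delta> n by (intro reward_distribution_chain_pmf) auto
  then obtain A where "ennreal (1 - \<epsilon>) * expected_max n ?F \<le> expected_alg ?F k A ord"
    using suff ord unfolding sufficient_copies_def by blast
  also have "\<dots> \<le> 1"
  \<comment> \<open>The reference \<open>w\<close> is the path that never dies: any copy still alive
    at type \<open>j\<close> agrees with it up to \<open>j\<close>.\<close>
  proof (rule expected_alg_le_1[OF ord, where w = "chain B \<delta> n n" and B = B])
    show "(\<integral>\<^sup>+ y. ennreal (y j) \<partial>?F) = ennreal B" if "0 < j" "j < n" for j
      using that \<delta> B by (intro chain_pmf_mean) auto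
  qed (use n B kB in \<open>auto simp: chain_pmf_def chain_def level_def split: if_splits\<close>)
  finally have "ennreal (1 - \<epsilon>) * expected_max n ?F \<le> 1" .
  moreover have "ennreal (1 - \<epsilon>) * ennreal ((1 - \<delta>) * (1 + real (n - 1) * B)) \<le>
      ennreal (1 - \<epsilon>) * expected_max n ?F"
    using \<delta> B n by (intro mult_left_mono expected_max_chain_pmf) auto
  ultimately have "ennreal ((1 - \<epsilon>) * ((1 - \<delta>) * (1 + real (n - 1) * B))) \<le> ennreal 1"
    using \<epsilon> \<delta> B by (simp add: ennreal_mult)
  then have "(1 - \<epsilon>) * ((1 - \<delta>) * (1 + real (n - 1) * B)) \<le> 1"
    by (subst (asm) ennreal_le_iff) auto
  moreover have "real (n - 1) * B = 2 * \<epsilon> / (1 - \<epsilon>)"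
    using n \<epsilon> by (simp add: B_def)
  then have "(1 - \<epsilon>) * (1 + real (n - 1) * B) = 1 + \<epsilon>"
    using \<epsilon> by (simp only:) (simp add: field_simps)
  ultimately have "(1 - \<delta>) * (1 + \<epsilon>) \<le> 1" by (simp add: mult_ac)
  moreover have "(1 - \<epsilon> / 4) * (1 + \<epsilon>) \<le> (1 - \<delta>) * (1 + \<epsilon>)"
    using \<delta> \<epsilon> by (intro mult_right_mono) auto
  moreover have "1 < (1 - \<epsilon> / 4) * (1 + \<epsilon>)"
  proof -
    have "\<epsilon> * \<epsilon> < \<epsilon> * 1" using \<epsilon> by (intro mult_strict_left_mono) auto
    then show ?thesis using \<epsilon> by (simp add: algebra_simps)
  qed
  ultimately show False by linarith
qed

section \<open>The order of the competition complexity\<close>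

text \<open>The least element exists because the rounded-up linear bound suffices; rounding costs
  the summand 1.\<close>

lemma sufficient_copies_competition_complexity:
  assumes "1 \<le> n" "0 < \<epsilon>"
  shows "sufficient_copies n \<epsilon> (competition_complexity n \<epsilon>)"
    "real (competition_complexity n \<epsilon>) \<le> 4 * real n / \<epsilon> + 1"
proof -
  let ?k = "nat \<lceil>4 * real n / \<epsilon>\<rceil>"
  have nonneg: "0 \<le> 4 * real n / \<epsilon>" using assms by simp
  have k: "sufficient_copies n \<epsilon> ?k"
    by (rule sufficient_copies_linear[OF assms real_nat_ceiling_ge])
  show "sufficient_copies n \<epsilon> (competition_complexity n \<epsilon>)"
    unfolding competition_complexity_def by (rule LeastI[of "sufficient_copies n \<epsilon>", OF k])
  have "competition_complexity n \<epsilon> \<le> ?k"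
    unfolding competition_complexity_def by (rule Least_le[of "sufficient_copies n \<epsilon>", OF k])
  then show "real (competition_complexity n \<epsilon>) \<le> 4 * real n / \<epsilon> + 1"
    using nonneg by linarith
qed

lemma competition_complexity_le:
  assumes n: "1 \<le> n" and \<epsilon>: "0 < \<epsilon>" "\<epsilon> < 1"
  shows "real (competition_complexity n \<epsilon>) \<le> 5 * (real n / \<epsilon>)"
proof -
  \<comment> \<open>Since \<open>\<epsilon> < 1\<close>, the rounding term is absorbed, turning the
    constant 4 into 5.\<close>
  have "1 \<le> real n / \<epsilon>" using n \<epsilon> by (simp add: field_simps)
  then show ?thesis using sufficient_copies_competition_complexity(2)[OF n \<epsilon>(1)] by simp
qed

lemma competition_complexity_ge:
  assumes n: "2 \<le> n" and \<epsilon>: "0 < \<epsilon>" "\<epsilon> \<le> \<epsilon>\<^sub>0" "\<epsilon>\<^sub>0 < 1"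
  shows "(1 - \<epsilon>\<^sub>0) / 4 * (real n / \<epsilon>) \<le> real (competition_complexity n \<epsilon>)"
proof -
  have "(1 - \<epsilon>\<^sub>0) / 4 * (real n / \<epsilon>) = (1 - \<epsilon>\<^sub>0) * (real n / 2) / (2 * \<epsilon>)" by simp
  \<comment> \<open>For \<open>n \<ge> 2\<close>, \<open>n - 1\<close> is at least
    \<open>n / 2\<close>.\<close>
  also have "\<dots> \<le> (1 - \<epsilon>) * real (n - 1) / (2 * \<epsilon>)"
    using n \<epsilon> by (intro divide_right_mono mult_mono) auto
  also have "\<dots> \<le> real (competition_complexity n \<epsilon>)"
    using sufficient_copies_lower[OF sufficient_copies_competition_complexity(1)] n \<epsilon>
    by (simp add: less_imp_le)
  finally show ?thesis .
qed

theorem theorem4p1: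
  "(\<forall>(n::nat) (\<epsilon>::real). 1 \<le> n \<and> 0 < \<epsilon> \<longrightarrow> (\<exists>k\<^sub>0. sufficient_copies n \<epsilon> k\<^sub>0)) \<and>
   (\<lambda>(n, \<epsilon>). real (competition_complexity n \<epsilon>))
      \<in> O[principal {(n::nat, \<epsilon>::real). 1 \<le> n \<and> 0 < \<epsilon> \<and> \<epsilon> < 1}](\<lambda>(n, \<epsilon>). real n / \<epsilon>) \<and>
   (\<forall>\<epsilon>\<^sub>0::real. 0 < \<epsilon>\<^sub>0 \<and> \<epsilon>\<^sub>0 < 1 \<longrightarrow>
      (\<lambda>(n, \<epsilon>). real (competition_complexity n \<epsilon>))
        \<in> \<Theta>[principal {(n::nat, \<epsilon>::real). 2 \<le> n \<and> 0 < \<epsilon> \<and> \<epsilon> \<le> \<epsilon>\<^sub>0}](\<lambda>(n, \<epsilon>). real n / \<epsilon>))"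
proof (intro conjI allI impI)
  fix n :: nat and \<epsilon> :: real
  assume "1 \<le> n \<and> 0 < \<epsilon>"
  then show "\<exists>k\<^sub>0. sufficient_copies n \<epsilon> k\<^sub>0"
    using sufficient_copies_competition_complexity(1) by blast
next
  show "(\<lambda>(n, \<epsilon>). real (competition_complexity n \<epsilon>))
      \<in> O[principal {(n::nat, \<epsilon>::real). 1 \<le> n \<and> 0 < \<epsilon> \<and> \<epsilon> < 1}](\<lambda>(n, \<epsilon>). real n / \<epsilon>)"
    using competition_complexity_le
    by (intro bigoI[of _ 5]) (auto simp: eventually_principal)
next
  fix \<epsilon>\<^sub>0 :: real
  assume \<epsilon>\<^sub>0: "0 < \<epsilon>\<^sub>0 \<and> \<epsilon>\<^sub>0 < 1"
  let ?D = "principal {(n::nat, \<epsilon>::real). 2 \<le> n \<and> 0 < \<epsilon> \<and> \<epsilon> \<le> \<epsilon>\<^sub>0}"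
  show "(\<lambda>(n, \<epsilon>). real (competition_complexity n \<epsilon>)) \<in> \<Theta>[?D](\<lambda>(n, \<epsilon>). real n / \<epsilon>)"
  proof (rule bigthetaI)
    show "(\<lambda>(n, \<epsilon>). real (competition_complexity n \<epsilon>)) \<in> O[?D](\<lambda>(n, \<epsilon>). real n / \<epsilon>)"
      using competition_complexity_le \<epsilon>\<^sub>0
      by (intro bigoI[of _ 5]) (auto simp: eventually_principal)
    show "(\<lambda>(n, \<epsilon>). real (competition_complexity n \<epsilon>)) \<in> \<Omega>[?D](\<lambda>(n, \<epsilon>). real n / \<epsilon>)"
      using competition_complexity_ge \<epsilon>\<^sub>0
      by (intro landau_omega.bigI[of "(1 - \<epsilon>\<^sub>0) / 4"]) (auto simp: eventually_principal field_simps)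
  qed
qed

end
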